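(* Let $N\ge2$ and $1\le m\le M$, and let $\{\mathcal{W}_i\}_{i=1}^N$ be an equi-distance tight fusion frame for $\mathbb{R}^M$ consisting of $m$-dimensional subspaces. Then $\{\mathcal{W}_i\}_{i=1}^N$ is an optimal Grassmannian packing: for every collection $\{\mathcal{V}_i\}_{i=1}^N$ of $m$-dimensional subspaces of $\mathbb{R}^M$, $$\min_{i\ne j}d_c(\mathcal{V}_i,\mathcal{V}_j)\le\min_{i\neq j}d_c(\mathcal{W}_i,\mathcal{W}_j).$$
   Context: A tight fusion frame for $\mathbb{R}^M$ is a finite collection of subspaces $\{\mathcal{W}_i\}_{i=1}^N$ of $\mathbb{R}^M$ whose orthogonal projections $\mathbf{P}_i$ satisfy $\sum_{i=1}^N\mathbf{P}_i=A\,\mathbf{I}$ for some $A>0$. The chordal distance between two $m$-dimensional subspaces $\mathcal{V},\mathcal{W}$ with orthogonal projections $\mathbf{Q}_1,\mathbf{Q}_2$ is $d_c(\mathcal{V},\mathcal{W})=\frac{1}{\sqrt2}\|\mathbf{Q}_1-\mathbf{Q}_2\|$, with the Frobenius (Euclidean) norm of matrices; equivalently $d_c^2=\sum_{\ell=1}^m\sin^2\theta_\ell=m-\mathrm{tr}[\mathbf{Q}_1\mathbf{Q}_2]$, where $\theta_1,\dots,\theta_m$ are the principal angles between the two subspaces. An equi-distance tight fusion frame is a tight fusion frame whose subspaces all have the same dimension and all have equal pairwise chordal distances. For given $m,M,N$, a collection of $N$ $m$-dimensional subspaces of $\mathbb{R}^M$ is an optimal (Grassmannian) packing if its minimum pairwise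 chordal distance is as large as possible among all such collections. *)

theory Defs
  imports "HOL-Analysis.Analysis"
begin

text \<open>
  The ambient space \<open>\<real>\<^sup>M\<close> is \<^typ>\<open>real^'M\<close> with \<open>M = CARD('M)\<close>. A collection
  of \<open>N\<close> subspaces is a family indexed by \<open>{..<N}\<close>, so repetitions are allowed; the values of the
  family at indices \<open>\<ge> N\<close> are irrelevant.
\<close>

definition orth_proj :: "(real^'M) set \<Rightarrow> real^'M^'M" where
  "orth_proj W = (THE P. \<forall>x. P *v x \<in> W \<and> (\<forall>w\<in>W. orthogonal (x - P *v x) w))"

text \<open>On subspaces the definite description is well defined.\<close>

lemma orth_proj_ex1:
  fixes W :: "(real^'M) set"
  assumes W: "subspace W"
  shows "\<exists>!P :: real^'M^'M. \<forall>x. P *v x \<in> W \<and> (\<forall>w\<in>W. orthogonal (x - P *v x) w)"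
proof (rule ex_ex1I)
  obtain B where B: "B \<subseteq> W" "pairwise orthogonal B" "\<And>x. x \<in> B \<Longrightarrow> norm x = 1"
    and indB: "independent B" and "card B = dim W" and spanB: "span B = W"
    using orthonormal_basis_subspace[OF W] by metis
  have finB: "finite B"
    using indB by (rule independent_imp_finite)
  define f where "f x = (\<Sum>b\<in>B. (x \<bullet> b) *\<^sub>R b)" for x
  have lin: "linear f"
    by (rule linearI)
      (simp_all add: f_def inner_left_distrib scaleR_left_distrib sum.distrib scaleR_sum_right)
  have inW: "f x \<in> W" for x
    using B(1) W unfolding f_def by (auto intro!: subspace_sum subspace_scale)
  have orth: "orthogonal (x - f x) w" if "w \<in> W" for x w
  proof (rule orthogonal_to_span)
    show "w \<in> span B"
      using that spanB by simp
    fix b assume b: "b \<in> B"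
    have "f x \<bullet> b = (\<Sum>c\<in>B. (x \<bullet> c) * (c \<bullet> b))"
      by (simp add: f_def inner_sum_left)
    also have "\<dots> = (\<Sum>c\<in>B. if c = b then x \<bullet> b else 0)"
    proof (rule sum.cong)
      fix c assume "c \<in> B"
      then show "(x \<bullet> c) * (c \<bullet> b) = (if c = b then x \<bullet> b else 0)"
        using B(2) B(3)[OF b] b by (auto simp: pairwise_def orthogonal_def norm_eq_1)
    qed simp
    also have "\<dots> = x \<bullet> b"
      using finB b by simp
    finally show "orthogonal (x - f x) b"
      by (simp add: orthogonal_def inner_diff_left)
  qed
  show "\<exists>P :: real^'M^'M. \<forall>x. P *v x \<in> W \<and> (\<forall>w\<in>W. orthogonal (x - P *v x) w)"
    by (rule exI[of _ "matrix f"]) (simp add: matrix_works[OF lin[folded linear_matrix_vector_mul_eq]] inW orth)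
next
  fix P Q :: "real^'M^'M"
  assume P: "\<forall>x. P *v x \<in> W \<and> (\<forall>w\<in>W. orthogonal (x - P *v x) w)"
    and Q: "\<forall>x. Q *v x \<in> W \<and> (\<forall>w\<in>W. orthogonal (x - Q *v x) w)"
  show "P = Q"
    unfolding matrix_eq
  proof
    fix x
    have "P *v x - Q *v x \<in> W"
      using P Q W by (simp add: subspace_diff)
    then have "(x - Q *v x) \<bullet> (P *v x - Q *v x) = 0" "(x - P *v x) \<bullet> (P *v x - Q *v x) = 0"
      using P Q by (auto simp: orthogonal_def)
    then have "(P *v x - Q *v x) \<bullet> (P *v x - Q *v x) = 0"
      by (simp add: inner_diff_left)
    then show "P *v x = Q *v x"
      by simp
  qed
qed

definition tight_fusion_frame :: "nat \<Rightarrow> (nat \<Rightarrow> (real^'M) set) \<Rightarrow> bool" where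
  "tight_fusion_frame N W \<longleftrightarrow>
     (\<forall>i<N. subspace (W i)) \<and>
     (\<exists>A>0. (\<Sum>i<N. orth_proj (W i)) = A *\<^sub>R mat 1)"

text \<open>The library norm on \<^typ>\<open>real^'M^'M\<close> is the Frobenius norm.\<close>

definition chordal_dist :: "(real^'M) set \<Rightarrow> (real^'M) set \<Rightarrow> real" where
  "chordal_dist V W = norm (orth_proj V - orth_proj W) / sqrt 2"

definition equi_distance_tff :: "nat \<Rightarrow> (nat \<Rightarrow> (real^'M) set) \<Rightarrow> bool" where
  "equi_distance_tff N W \<longleftrightarrow>
     tight_fusion_frame N W \<and>
     (\<exists>m. \<forall>i<N. dim (W i) = m) \<and>
     (\<exists>d. \<forall>i<N. \<forall>j<N. i \<noteq> j \<longrightarrow> chordal_dist (W i) (W j) = d)"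

text \<open>Meaningful only for \<open>N \<ge> 2\<close>, when the set is nonempty.\<close>

definition min_chordal_dist :: "nat \<Rightarrow> (nat \<Rightarrow> (real^'M) set) \<Rightarrow> real" where
  "min_chordal_dist N W = Min {chordal_dist (W i) (W j) | i j. i < N \<and> j < N \<and> i \<noteq> j}"

definition optimal_grassmannian_packing :: "nat \<Rightarrow> nat \<Rightarrow> (nat \<Rightarrow> (real^'M) set) \<Rightarrow> bool" where
  "optimal_grassmannian_packing N m W \<longleftrightarrow>
     (\<forall>i<N. subspace (W i) \<and> dim (W i) = m) \<and>
     (\<forall>V :: nat \<Rightarrow> (real^'M) set. (\<forall>i<N. subspace (V i) \<and> dim (V i) = m) \<longrightarrow>
        min_chordal_dist N V \<le> min_chordal_dist N W)"

end

theory Submission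
  imports Defs
begin

text \<open>
  This is the equality case of the simplex bound. In the Euclidean space of \<open>M \<times> M\<close> matrices, the
  orthogonal projection onto an \<open>m\<close>-dimensional subspace has squared norm \<open>m\<close> and inner product
  \<open>m\<close> with the identity \<open>I\<close> (lemmas \<open>orth_proj_norm_square\<close> and \<open>orth_proj_inner_mat_1\<close>), and
  \<open>I\<close> itself has squared norm \<open>M\<close>. So if \<open>S\<close> denotes the sum of the projections onto \<open>N\<close>
  subspaces of dimension \<open>m\<close>, their squared chordal distances over all ordered pairs add up to
  \<open>N\<^sup>2 m - \<parallel>S\<parallel>\<^sup>2\<close> (lemma \<open>sum_chordal_dist_square\<close>). Since \<open>S\<close> has inner product \<open>N m\<close>
  with \<open>I\<close>, Cauchy--Schwarz gives \<open>\<parallel>S\<parallel>\<^sup>2 \<ge> (N m)\<^sup>2 / M\<close>, with equality when \<open>S\<close> is a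
  multiple of \<open>I\<close>, that is, for a tight fusion frame. Hence a tight fusion frame maximizes the
  mean squared distance. In any family the minimum distance is at most the root mean square of the
  distances, and the two agree when all distances are equal.
\<close>

definition outer_square :: "real^'n \<Rightarrow> real^'n^'n" where
  "outer_square b = (\<chi> i j. b $ i * b $ j)"

lemma outer_square_mult:
  "outer_square b *v x = (b \<bullet> x) *\<^sub>R b"
  by (simp add: outer_square_def matrix_vector_mult_def vec_eq_iff inner_vec_def
      sum_distrib_left mult_ac)

lemma outer_square_inner:
  "outer_square b \<bullet> outer_square c = (b \<bullet> c)\<^sup>2"
  by (simp add: outer_square_def inner_vec_def power2_eq_square sum_product mult_ac)

lemma outer_square_inner_mat_1:
  "outer_square b \<bullet> mat 1 = b \<bullet> b"
  by (simp add: outer_square_def inner_vec_def mat_def if_distrib cong: if_cong)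

lemma mat_1_norm_square:
  "(mat 1 :: real^'n^'n) \<bullet> mat 1 = real CARD('n)"
  by (simp add: inner_vec_def mat_def if_distrib cong: if_cong)

lemma orth_proj_eqI:
  assumes "subspace W"
    and "\<And>x. P *v x \<in> W"
    and "\<And>x w. w \<in> W \<Longrightarrow> orthogonal (x - P *v x) w"
  shows "orth_proj W = P"
  unfolding orth_proj_def using assms by (intro the1_equality orth_proj_ex1) auto

text \<open>
  This turns Frobenius inner products of projections into counting: the rank-one summands are
  themselves orthonormal, and each has trace \<open>1\<close>.
\<close>

lemma orth_proj_orthonormal_sum:
  fixes W :: "(real^'M) set"
  assumes W: "subspace W"
  obtains B where "finite B" "card B = dim W"
    "\<And>b c. b \<in> B \<Longrightarrow> c \<in> B \<Longrightarrow> b \<bullet> c = (if b = c then 1 else 0)"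
    "orth_proj W = (\<Sum>b\<in>B. outer_square b)"
proof -
  obtain B where B: "B \<subseteq> W" "pairwise orthogonal B" "\<And>x. x \<in> B \<Longrightarrow> norm x = 1"
    and indB: "independent B" and card: "card B = dim W" and spanB: "span B = W"
    using orthonormal_basis_subspace[OF W] by metis
  have fin: "finite B"
    using indB by (rule independent_imp_finite)
  have on: "b \<bullet> c = (if b = c then 1 else 0)" if "b \<in> B" "c \<in> B" for b c
    using that B(2) B(3) by (auto simp: pairwise_def orthogonal_def norm_eq_1)
  define P where "P = (\<Sum>b\<in>B. outer_square b)"
  have Px: "P *v x = (\<Sum>b\<in>B. (b \<bullet> x) *\<^sub>R b)" for x
    using fin unfolding P_def
    by induction (simp_all add: matrix_vector_mult_add_rdistrib outer_square_mult)
  have "orth_proj W = P"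
  proof (rule orth_proj_eqI[OF W])
    show "P *v x \<in> W" for x
      using B(1) W unfolding Px by (auto intro!: subspace_sum subspace_scale)
    show "orthogonal (x - P *v x) w" if "w \<in> W" for x w
    proof (rule orthogonal_to_span)
      show "w \<in> span B"
        using that spanB by simp
      fix c assume c: "c \<in> B"
      have "(P *v x) \<bullet> c = (\<Sum>b\<in>B. if b = c then c \<bullet> x else 0)"
        unfolding Px inner_sum_left by (rule sum.cong) (simp_all add: on c)
      also have "\<dots> = c \<bullet> x"
        using fin c by simp
      finally show "orthogonal (x - P *v x) c"
        by (simp add: orthogonal_def inner_diff_left inner_commute[of x])
    qed
  qed
  then show thesis
    using that[OF fin card on] unfolding P_def by blast
qed

lemma orth_proj_inner_mat_1:
  assumes "subspace W"
  shows "orth_proj W \<bullet> mat 1 = real (dim W)"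
proof -
  obtain B where "finite B" "card B = dim W"
    "\<And>b c. b \<in> B \<Longrightarrow> c \<in> B \<Longrightarrow> b \<bullet> c = (if b = c then 1 else 0)"
    "orth_proj W = (\<Sum>b\<in>B. outer_square b)"
    using orth_proj_orthonormal_sum[OF assms] by blast
  then show ?thesis
    by (simp add: inner_sum_left outer_square_inner_mat_1)
qed

lemma orth_proj_norm_square:
  assumes "subspace W"
  shows "(norm (orth_proj W))\<^sup>2 = real (dim W)"
proof -
  obtain B where B: "finite B" "card B = dim W"
    "\<And>b c. b \<in> B \<Longrightarrow> c \<in> B \<Longrightarrow> b \<bullet> c = (if b = c then 1 else 0)"
    "orth_proj W = (\<Sum>b\<in>B. outer_square b)"
    using orth_proj_orthonormal_sum[OF assms] by blast
  have "orth_proj W \<bullet> orth_proj W = (\<Sum>b\<in>B. \<Sum>c\<in>B. (b \<bullet> c)\<^sup>2)"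
    by (simp add: B(4) inner_sum_left inner_sum_right outer_square_inner inner_commute)
  also have "\<dots> = (\<Sum>b\<in>B. \<Sum>c\<in>B. if b = c then 1 else 0)"
    by (intro sum.cong) (simp_all add: B(3))
  also have "\<dots> = real (dim W)"
    using B(1,2) by simp
  finally show ?thesis
    by (simp add: power2_norm_eq_inner)
qed

lemma sum_dist_square:
  fixes x :: "'i \<Rightarrow> 'a::real_inner"
  assumes "finite I"
  shows "(\<Sum>i\<in>I. \<Sum>j\<in>I. (norm (x i - x j))\<^sup>2)
       = 2 * real (card I) * (\<Sum>i\<in>I. (norm (x i))\<^sup>2) - 2 * (norm (\<Sum>i\<in>I. x i))\<^sup>2"
proof -
  have "(\<Sum>i\<in>I. \<Sum>j\<in>I. (norm (x i - x j))\<^sup>2)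
      = (\<Sum>i\<in>I. \<Sum>j\<in>I. (x i \<bullet> x i + x j \<bullet> x j) - 2 * (x i \<bullet> x j))"
    by (intro sum.cong refl)
      (simp add: power2_norm_eq_inner inner_diff_left inner_diff_right inner_commute)
  then show ?thesis
    by (simp add: sum_subtractf sum.distrib power2_norm_eq_inner inner_sum_left inner_sum_right
        flip: sum_distrib_left)
      (metis (no_types, lifting) inner_commute sum.cong)
qed

lemma chordal_dist_nonneg: "0 \<le> chordal_dist V W"
  by (simp add: chordal_dist_def)

lemma sum_chordal_dist_square:
  assumes "\<And>i. i < N \<Longrightarrow> subspace (V i) \<and> dim (V i) = m"
  shows "(\<Sum>i<N. \<Sum>j\<in>{..<N} - {i}. (chordal_dist (V i) (V j))\<^sup>2)
       = (real N)\<^sup>2 * m - (norm (\<Sum>i<N. orth_proj (V i)))\<^sup>2"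
proof -
  have "(\<Sum>i<N. \<Sum>j\<in>{..<N} - {i}. (chordal_dist (V i) (V j))\<^sup>2)
      = (\<Sum>i<N. \<Sum>j<N. (chordal_dist (V i) (V j))\<^sup>2)"
    by (intro sum.cong refl sum.mono_neutral_left) (auto simp: chordal_dist_def)
  also have "\<dots> = (\<Sum>i<N. \<Sum>j<N. (norm (orth_proj (V i) - orth_proj (V j)))\<^sup>2) / 2"
    by (simp add: chordal_dist_def power_divide sum_divide_distrib)
  also have "\<dots> = (real N)\<^sup>2 * m - (norm (\<Sum>i<N. orth_proj (V i)))\<^sup>2"
    using assms unfolding sum_dist_square[OF finite_lessThan]
    by (simp add: orth_proj_norm_square) (simp add: power2_eq_square)
  finally show ?thesis .
qed

text \<open>
  Cauchy--Schwarz, applied to the sum of the projections and the identity matrix, bounds the norm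
  of that sum from below by its trace, and the trace depends only on the dimensions.
\<close>

lemma sum_chordal_dist_square_le:
  fixes V :: "nat \<Rightarrow> (real^'M) set"
  assumes V: "\<And>i. i < N \<Longrightarrow> subspace (V i) \<and> dim (V i) = m"
  shows "(\<Sum>i<N. \<Sum>j\<in>{..<N} - {i}. (chordal_dist (V i) (V j))\<^sup>2)
       \<le> (real N)\<^sup>2 * m - (real N * m)\<^sup>2 / CARD('M)"
proof -
  define S where "S = (\<Sum>i<N. orth_proj (V i))"
  have "S \<bullet> mat 1 = real N * m"
    using V by (simp add: S_def inner_sum_left orth_proj_inner_mat_1)
  then have "(real N * m)\<^sup>2 \<le> (norm S)\<^sup>2 * CARD('M)"
    using Cauchy_Schwarz_ineq[of S "mat 1"] by (simp add: mat_1_norm_square power2_norm_eq_inner)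
  then show ?thesis
    by (simp add: sum_chordal_dist_square[OF V] divide_le_eq flip: S_def)
qed

text \<open>
  Equality holds in the previous bound, because the sum \<open>A I\<close> of the projections is parallel to the
  identity matrix; comparing traces gives \<open>A = N m / M\<close>.
\<close>

lemma tight_fusion_frame_sum_chordal_dist_square:
  fixes W :: "nat \<Rightarrow> (real^'M) set"
  assumes tff: "tight_fusion_frame N W" and m: "\<And>i. i < N \<Longrightarrow> dim (W i) = m"
  shows "(\<Sum>i<N. \<Sum>j\<in>{..<N} - {i}. (chordal_dist (W i) (W j))\<^sup>2)
       = (real N)\<^sup>2 * m - (real N * m)\<^sup>2 / CARD('M)"
proof -
  obtain A where A: "(\<Sum>i<N. orth_proj (W i)) = A *\<^sub>R mat 1"
    using tff by (auto simp: tight_fusion_frame_def)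
  have W: "subspace (W i) \<and> dim (W i) = m" if "i < N" for i
    using that tff m by (simp add: tight_fusion_frame_def)
  have "(\<Sum>i<N. orth_proj (W i)) \<bullet> mat 1 = real N * m"
    using W by (simp add: inner_sum_left orth_proj_inner_mat_1)
  then have trace: "A * CARD('M) = real N * m"
    by (simp add: A mat_1_norm_square)
  have "(norm (\<Sum>i<N. orth_proj (W i)))\<^sup>2 = A\<^sup>2 * CARD('M)"
    unfolding A power2_norm_eq_inner by (simp add: mat_1_norm_square power2_eq_square)
  also have "\<dots> = (real N * m)\<^sup>2 / CARD('M)"
    by (simp add: power2_eq_square flip: trace)
  finally show ?thesis
    by (simp add: sum_chordal_dist_square[OF W])
qed

lemma finite_chordal_dists:
  fixes N :: nat
  shows "finite {chordal_dist (W i) (W j) | i j. i < N \<and> j < N \<and> i \<noteq> j}"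
  by (rule finite_subset[of _ "(\<lambda>(i, j). chordal_dist (W i) (W j)) ` ({..<N} \<times> {..<N})"]) auto

lemma chordal_dists_nonempty:
  assumes "N \<ge> (2::nat)"
  shows "{chordal_dist (W i) (W j) | i j. i < N \<and> j < N \<and> i \<noteq> j} \<noteq> {}"
proof -
  have "chordal_dist (W 0) (W 1) \<in> {chordal_dist (W i) (W j) | i j. i < N \<and> j < N \<and> i \<noteq> j}"
    using assms by fastforce
  then show ?thesis
    by blast
qed

lemma min_chordal_dist_le:
  assumes "i < N" "j < N" "i \<noteq> j"
  shows "min_chordal_dist N W \<le> chordal_dist (W i) (W j)"
  unfolding min_chordal_dist_def using assms by (intro Min_le finite_chordal_dists) blast

lemma min_chordal_dist_attained:
  assumes "N \<ge> 2"
  obtains i j where "i < N" "j < N" "i \<noteq> j" "min_chordal_dist N W = chordal_dist (W i) (W j)"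
  using Min_in[OF finite_chordal_dists chordal_dists_nonempty[OF assms]] that
  unfolding min_chordal_dist_def by blast

theorem corollary4p4:
  fixes N m :: nat
    and W :: "nat \<Rightarrow> (real^'M) set"
  assumes "N \<ge> 2"
    and "1 \<le> m" and "m \<le> CARD('M)"
    and "equi_distance_tff N W"
    and "\<forall>i<N. dim (W i) = m"
  shows "optimal_grassmannian_packing N m W"
  unfolding optimal_grassmannian_packing_def
proof (intro conjI allI impI)
  have tff: "tight_fusion_frame N W"
    using assms(4) by (simp add: equi_distance_tff_def)
  then show "subspace (W i)" if "i < N" for i
    using that by (simp add: tight_fusion_frame_def)
  show "dim (W i) = m" if "i < N" for i
    using that assms(5) by simp
  fix V :: "nat \<Rightarrow> (real^'M) set"
  assume V: "\<forall>i<N. subspace (V i) \<and> dim (V i) = m"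
  define a where "a = min_chordal_dist N V"
  obtain d where d: "\<And>i j. i < N \<Longrightarrow> j < N \<Longrightarrow> i \<noteq> j \<Longrightarrow> chordal_dist (W i) (W j) = d"
    using assms(4) by (auto simp: equi_distance_tff_def)
  have min_W: "min_chordal_dist N W = d"
    using min_chordal_dist_attained[OF assms(1), of W] d by metis
  then have "d \<ge> 0"
    using min_chordal_dist_attained[OF assms(1), of W] chordal_dist_nonneg by metis
  have "a \<ge> 0"
    unfolding a_def using min_chordal_dist_attained[OF assms(1), of V] chordal_dist_nonneg by metis
  have "real N * ((real N - 1) * a\<^sup>2) = (\<Sum>i<N. \<Sum>j\<in>{..<N} - {i}. a\<^sup>2)"
    using assms(1) by (simp add: of_nat_diff)
  also have "\<dots> \<le> (\<Sum>i<N. \<Sum>j\<in>{..<N} - {i}. (chordal_dist (V i) (V j))\<^sup>2)"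
    using \<open>a \<ge> 0\<close> unfolding a_def by (intro sum_mono power_mono min_chordal_dist_le) auto
  also have "\<dots> \<le> (real N)\<^sup>2 * m - (real N * m)\<^sup>2 / CARD('M)"
    using V by (intro sum_chordal_dist_square_le) blast
  also have "\<dots> = (\<Sum>i<N. \<Sum>j\<in>{..<N} - {i}. (chordal_dist (W i) (W j))\<^sup>2)"
    using tight_fusion_frame_sum_chordal_dist_square[OF tff] assms(5) by simp
  also have "\<dots> = (\<Sum>i<N. \<Sum>j\<in>{..<N} - {i}. d\<^sup>2)"
    by (intro sum.cong refl) (auto simp: d)
  also have "\<dots> = real N * ((real N - 1) * d\<^sup>2)"
    using assms(1) by (simp add: of_nat_diff)
  finally have "a\<^sup>2 \<le> d\<^sup>2"
    using assms(1) by simp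
  then show "min_chordal_dist N V \<le> min_chordal_dist N W"
    using \<open>d \<ge> 0\<close> unfolding min_W a_def by (rule power2_le_imp_le)
qed

end
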